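(* For every integer $n \geq 3$, the number of permutations $\pi$ of $\{1,2,\dots,n\}$ which contain exactly one occurrence of the pattern $123$ and no occurrence of the pattern $132$ equals $(n-2)2^{n-3}$.
   Context: A permutation $\pi$ of $\{1,\dots,n\}$ is written as the sequence $\pi(1)\pi(2)\cdots\pi(n)$. An occurrence of the pattern $123$ in $\pi$ is a triple of indices $i<j<k$ with $\pi(i)<\pi(j)<\pi(k)$. An occurrence of the pattern $132$ in $\pi$ is a triple of indices $i<j<k$ with $\pi(i)<\pi(k)<\pi(j)$. A permutation avoids a pattern if it has no occurrence of it. *)

theory Defs
  imports "HOL-Combinatorics.Permutations"
begin

definition occurrences_123 :: "nat \<Rightarrow> (nat \<Rightarrow> nat) \<Rightarrow> (nat \<times> nat \<times> nat) set" where
  "occurrences_123 n \<pi> =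
     {(i, j, k). i \<in> {1..n} \<and> j \<in> {1..n} \<and> k \<in> {1..n} \<and> i < j \<and> j < k \<and> \<pi> i < \<pi> j \<and> \<pi> j < \<pi> k}"

definition occurrences_132 :: "nat \<Rightarrow> (nat \<Rightarrow> nat) \<Rightarrow> (nat \<times> nat \<times> nat) set" where
  "occurrences_132 n \<pi> =
     {(i, j, k). i \<in> {1..n} \<and> j \<in> {1..n} \<and> k \<in> {1..n} \<and> i < j \<and> j < k \<and> \<pi> i < \<pi> k \<and> \<pi> k < \<pi> j}"

definition avoids_132 :: "nat \<Rightarrow> (nat \<Rightarrow> nat) \<Rightarrow> bool" where
  "avoids_132 n \<pi> \<longleftrightarrow> occurrences_132 n \<pi> = {}"

end

(* The entries exceeding the first entry x of a 132-avoiding permutation increase, so if there are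
   m of them then exactly (m choose 2) occurrences of 123 start at x.  With a single occurrence of
   123 in total, x is therefore one of the three largest values.  If x is the largest or the second
   largest, the rest is again such a permutation; if x is the third largest, the rest avoids both
   patterns and has its two largest values in increasing order, which forces it to start with the
   second largest.  As 2^(n-1) permutations avoid both patterns, the count satisfies
   a(n) = 2 a(n-1) + 2^(n-3). *)
theory Submission
  imports Defs "HOL-Combinatorics.Multiset_Permutations"
begin

section \<open>Pattern occurrences in lists\<close>

fun pair_count :: "('a \<Rightarrow> 'a \<Rightarrow> bool) \<Rightarrow> 'a list \<Rightarrow> nat" where
  "pair_count P [] = 0"
| "pair_count P (x # xs) = length (filter (P x) xs) + pair_count P xs"

fun triple_count :: "('a \<Rightarrow> 'a \<Rightarrow> 'a \<Rightarrow> bool) \<Rightarrow> 'a list \<Rightarrow> nat" where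
  "triple_count P [] = 0"
| "triple_count P (x # xs) = pair_count (P x) xs + triple_count P xs"

abbreviation count_123 :: "'a::linorder list \<Rightarrow> nat" where
  "count_123 \<equiv> triple_count (\<lambda>x y z. x < y \<and> y < z)"

abbreviation count_132 :: "'a::linorder list \<Rightarrow> nat" where
  "count_132 \<equiv> triple_count (\<lambda>x y z. x < z \<and> z < y)"

lemma length_filter_map_upt:
  "length (filter P (map f [m..<n])) = card {i. m \<le> i \<and> i < n \<and> P (f i)}"
proof -
  have "length (filter P (map f [m..<n])) = card (set (filter (P \<circ> f) [m..<n]))"
    by (subst distinct_card) (simp_all add: filter_map)
  also have "set (filter (P \<circ> f) [m..<n]) = {i. m \<le> i \<and> i < n \<and> P (f i)}"
    by auto
  finally show ?thesis .
qed

lemma pair_count_map_upt: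
  "pair_count P (map f [m..<n]) = card {(i, j). m \<le> i \<and> i < j \<and> j < n \<and> P (f i) (f j)}"
proof (induction "n - m" arbitrary: m)
  case 0
  then have "{(i, j). m \<le> i \<and> i < j \<and> j < n \<and> P (f i) (f j)} = {}" by auto
  with 0 show ?case by (simp only: card.empty) simp
next
  case (Suc d)
  then have m: "m < n" and d: "d = n - Suc m" by auto
  define A where "A = Pair m ` {j. Suc m \<le> j \<and> j < n \<and> P (f m) (f j)}"
  define B where "B = {(i, j). Suc m \<le> i \<and> i < j \<and> j < n \<and> P (f i) (f j)}"
  have fin: "finite A" "finite B"
    unfolding A_def B_def by (auto intro: finite_subset[of _ "{..<n} \<times> {..<n}"])
  have "{(i, j). m \<le> i \<and> i < j \<and> j < n \<and> P (f i) (f j)} = A \<union> B"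
    by (auto simp: A_def B_def image_iff Suc_le_eq le_less)
  moreover have "A \<inter> B = {}" by (auto simp: A_def B_def)
  moreover have "card A = card {j. Suc m \<le> j \<and> j < n \<and> P (f m) (f j)}"
    unfolding A_def by (intro card_image inj_onI) simp
  ultimately have "card {(i, j). m \<le> i \<and> i < j \<and> j < n \<and> P (f i) (f j)}
      = length (filter (P (f m)) (map f [Suc m..<n])) + card B"
    using fin by (simp only: length_filter_map_upt card_Un_disjoint)
  then show ?case
    using Suc.hyps(1)[OF d] m by (simp add: upt_conv_Cons B_def)
qed

lemma triple_count_map_upt:
  "triple_count P (map f [m..<n])
    = card {(i, j, k). m \<le> i \<and> i < j \<and> j < k \<and> k < n \<and> P (f i) (f j) (f k)}"
proof (induction "n - m" arbitrary: m)
  case 0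
  then have "{(i, j, k). m \<le> i \<and> i < j \<and> j < k \<and> k < n \<and> P (f i) (f j) (f k)} = {}" by auto
  with 0 show ?case by (simp only: card.empty) simp
next
  case (Suc d)
  then have m: "m < n" and d: "d = n - Suc m" by auto
  define A where "A = Pair m ` {(j, k). Suc m \<le> j \<and> j < k \<and> k < n \<and> P (f m) (f j) (f k)}"
  define B where "B = {(i, j, k). Suc m \<le> i \<and> i < j \<and> j < k \<and> k < n \<and> P (f i) (f j) (f k)}"
  have fin: "finite A" "finite B"
    unfolding A_def B_def using m
    by (auto intro: finite_subset[of _ "{..<n} \<times> {..<n} \<times> {..<n}"] finite_subset[of _ "{..<n} \<times> {..<n}"])
  have "{(i, j, k). m \<le> i \<and> i < j \<and> j < k \<and> k < n \<and> P (f i) (f j) (f k)} = A \<union> B"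
    by (auto simp: A_def B_def image_iff Suc_le_eq le_less)
  moreover have "A \<inter> B = {}" by (auto simp: A_def B_def)
  moreover have "card A = card {(j, k). Suc m \<le> j \<and> j < k \<and> k < n \<and> P (f m) (f j) (f k)}"
    unfolding A_def by (intro card_image inj_onI) simp
  ultimately have "card {(i, j, k). m \<le> i \<and> i < j \<and> j < k \<and> k < n \<and> P (f i) (f j) (f k)}
      = pair_count (P (f m)) (map f [Suc m..<n]) + card B"
    using fin by (simp only: pair_count_map_upt card_Un_disjoint)
  then show ?case
    using Suc.hyps(1)[OF d] m by (simp add: upt_conv_Cons B_def)
qed

lemma pair_count_above:
  fixes xs :: "'a::linorder list"
  assumes "distinct xs"
  shows "pair_count (\<lambda>y z. x < y \<and> y < z) xs + pair_count (\<lambda>y z. x < z \<and> z < y) xs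
    = card {y \<in> set xs. x < y} choose 2"
  using assms
proof (induction xs)
  case Nil
  then show ?case by simp
next
  case (Cons a xs)
  let ?m = "card {y \<in> set xs. x < y}"
  show ?case
  proof (cases "x < a")
    case True
    have "length (filter (\<lambda>z. a < z) xs) + length (filter (\<lambda>z. x < z \<and> z < a) xs)
        = card {y \<in> set xs. a < y} + card {y \<in> set xs. x < y \<and> y < a}"
      using Cons.prems by (simp add: distinct_length_filter Int_def conj_commute)
    also have "\<dots> = card ({y \<in> set xs. a < y} \<union> {y \<in> set xs. x < y \<and> y < a})"
      by (rule card_Un_disjoint[symmetric]) auto
    also have "{y \<in> set xs. a < y} \<union> {y \<in> set xs. x < y \<and> y < a} = {y \<in> set xs. x < y}"
      using Cons.prems True by (auto simp: not_less le_less)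
    finally have len: "length (filter (\<lambda>z. a < z) xs)
      + length (filter (\<lambda>z. x < z \<and> z < a) xs) = ?m" .
    have "{y \<in> set (a # xs). x < y} = insert a {y \<in> set xs. x < y}"
      using True by auto
    then have "card {y \<in> set (a # xs). x < y} = Suc ?m"
      using Cons.prems by simp
    moreover have "Suc ?m choose 2 = ?m + (?m choose 2)"
      by (simp add: numeral_2_eq_2)
    ultimately show ?thesis
      using Cons True len by simp
  next
    case False
    then have "{y \<in> set (a # xs). x < y} = {y \<in> set xs. x < y}" by auto
    moreover have none: "filter (\<lambda>z. x < z \<and> z < a) xs = []"
      using False by (auto simp: filter_empty_conv)
    ultimately show ?thesis
      using Cons False by simp
  qed
qed

section \<open>Counting by the first entry\<close>

definition avoiders_132 :: "'a::linorder set \<Rightarrow> nat \<Rightarrow> 'a list set" where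
  "avoiders_132 S v = {xs \<in> permutations_of_set S. count_123 xs = v \<and> count_132 xs = 0}"

lemma finite_avoiders_132 [simp]: "finite (avoiders_132 S v)"
  by (simp add: avoiders_132_def)

lemma Cons_in_avoiders_132_iff:
  "x # xs \<in> avoiders_132 S v \<longleftrightarrow>
    x \<in> S \<and> pair_count (\<lambda>y z. x < z \<and> z < y) xs = 0 \<and>
    (\<exists>w. xs \<in> avoiders_132 (S - {x}) w \<and> (card {y \<in> S. x < y} choose 2) + w = v)"
proof (cases "x \<in> S \<and> xs \<in> permutations_of_set (S - {x})")
  case True
  then have "set xs = S - {x}" "distinct xs"
    by (auto simp: permutations_of_set_def)
  then have "{y \<in> set xs. x < y} = {y \<in> S. x < y}" by auto
  then have "pair_count (\<lambda>y z. x < y \<and> y < z) xs + pair_count (\<lambda>y z. x < z \<and> z < y) xs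
      = card {y \<in> S. x < y} choose 2"
    using pair_count_above[OF \<open>distinct xs\<close>, of x] by simp
  moreover have "x # xs \<in> permutations_of_set S"
    using True by (auto simp: permutations_of_set_def)
  ultimately show ?thesis
    using True by (auto simp: avoiders_132_def)
next
  case False
  then show ?thesis
    by (auto simp: avoiders_132_def permutations_of_set_def)
qed

lemma pair_count_above_eq_0:
  assumes "xs \<in> avoiders_132 (S - {x}) w" "card {y \<in> S. x < y} \<le> 1"
  shows "pair_count (\<lambda>y z. x < z \<and> z < y) xs = 0"
proof -
  have "set xs = S - {x}" "distinct xs"
    using assms by (auto simp: avoiders_132_def permutations_of_set_def)
  then have "{y \<in> set xs. x < y} = {y \<in> S. x < y}" by auto
  with pair_count_above[OF \<open>distinct xs\<close>, of x] assms(2) show ?thesis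
    by (simp add: binomial_eq_0)
qed

lemma Cons_in_avoiders_132_iff_low:
  assumes "x \<in> S" "card {y \<in> S. x < y} \<le> 1"
  shows "x # xs \<in> avoiders_132 S v \<longleftrightarrow> xs \<in> avoiders_132 (S - {x}) v"
  using assms pair_count_above_eq_0[OF _ assms(2)]
  by (auto simp: Cons_in_avoiders_132_iff binomial_eq_0)

lemma obtain_Max:
  fixes S :: "'a::linorder set"
  assumes "card S = Suc n"
  obtains M T where "S = insert M T" "card T = n" "finite T" "\<forall>t\<in>T. t < M"
proof
  have "finite S" "S \<noteq> {}"
    using assms by (auto intro: card_ge_0_finite)
  then show "S = insert (Max S) (S - {Max S})" "finite (S - {Max S})"
    "card (S - {Max S}) = n" "\<forall>t\<in>S - {Max S}. t < Max S"
    using assms by (auto simp: less_le insert_absorb)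
qed

lemma Nil_in_avoiders_132_iff: "[] \<in> avoiders_132 S v \<longleftrightarrow> S = {} \<and> v = 0"
  by (auto simp: avoiders_132_def permutations_of_set_def)

lemma card_ge_2_if:
  assumes "finite A" "a \<in> A" "b \<in> A" "a \<noteq> b"
  shows "2 \<le> card A"
  using card_mono[of A "{a, b}"] assms by simp

lemma le_2_if_choose_2_le_1:
  assumes "m choose 2 \<le> 1"
  shows "m \<le> 2"
proof (rule ccontr)
  assume "\<not> m \<le> 2"
  then have "m = Suc (Suc (Suc (m - 3)))" by simp
  then obtain k where "m = Suc (Suc (Suc k))" ..
  with assms show False by (simp add: numeral_2_eq_2)
qed

lemma avoiders_132_0_eq:
  assumes S: "S = insert M (insert N T)" and fin: "finite T" and ord: "N < M" "\<forall>t\<in>T. t < N"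
  shows "avoiders_132 S 0
    = (#) M ` avoiders_132 (insert N T) 0 \<union> (#) N ` avoiders_132 (insert M T) 0"
proof -
  have above: "{y \<in> S. M < y} = {}" "{y \<in> S. N < y} = {M}"
    using S ord by (auto dest: less_trans)
  have low: "card {y \<in> S. M < y} \<le> 1" "card {y \<in> S. N < y} \<le> 1"
    unfolding above by simp_all
  have del: "S - {M} = insert N T" "S - {N} = insert M T"
    using S ord by auto
  have head: "y = M \<or> y = N" if "y # ys \<in> avoiders_132 S 0" for y ys
  proof (rule ccontr)
    assume "\<not> (y = M \<or> y = N)"
    moreover from that have "y \<in> S" and c: "card {z \<in> S. y < z} choose 2 = 0"
      by (auto simp: Cons_in_avoiders_132_iff)
    ultimately have "y \<in> T" using S by auto
    then have "2 \<le> card {z \<in> S. y < z}"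
      using S fin ord by (intro card_ge_2_if[of _ M N]) auto
    with c show False by simp
  qed
  have "M # ys \<in> avoiders_132 S 0 \<longleftrightarrow> ys \<in> avoiders_132 (insert N T) 0"
    "N # ys \<in> avoiders_132 S 0 \<longleftrightarrow> ys \<in> avoiders_132 (insert M T) 0" for ys
    using Cons_in_avoiders_132_iff_low[OF _ low(1)] Cons_in_avoiders_132_iff_low[OF _ low(2)]
      S del by auto
  then have "y # ys \<in> avoiders_132 S 0 \<longleftrightarrow> y = M \<and> ys \<in> avoiders_132 (insert N T) 0
      \<or> y = N \<and> ys \<in> avoiders_132 (insert M T) 0" for y ys
    using head[of y ys] by metis
  moreover have "[] \<notin> avoiders_132 S 0"
    using S by (simp add: Nil_in_avoiders_132_iff)
  ultimately have "xs \<in> avoiders_132 S 0 \<longleftrightarrow> xs \<in> (#) M ` avoiders_132 (insert N T) 0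
      \<union> (#) N ` avoiders_132 (insert M T) 0" for xs
    by (cases xs) auto
  then show ?thesis by blast
qed

lemma card_Cons_image: "card ((#) x ` A) = card A"
  by (intro card_image inj_onI) simp

lemma card_avoiders_132_0:
  fixes S :: "'a::linorder set"
  assumes "card S = Suc n"
  shows "card (avoiders_132 S 0) = 2 ^ n"
  using assms
proof (induction n arbitrary: S)
  case 0
  then obtain a where "S = {a}" by (auto simp: card_1_singleton_iff)
  then have "avoiders_132 S 0 = {[a]}" by (auto simp: avoiders_132_def)
  then show ?case by simp
next
  case (Suc n)
  obtain M S1 where S: "S = insert M S1" "card S1 = Suc n" "\<forall>t\<in>S1. t < M"
    using obtain_Max[OF Suc.prems] by metis
  obtain N T where T: "S1 = insert N T" "card T = n" "finite T" "\<forall>t\<in>T. t < N"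
    using obtain_Max[OF S(2)] by metis
  have "M \<notin> T" "N < M" using S T by auto
  then have "card (insert M T) = Suc n" using T by simp
  moreover have "(#) M ` avoiders_132 (insert N T) 0 \<inter> (#) N ` avoiders_132 (insert M T) 0 = {}"
    using \<open>N < M\<close> by auto
  ultimately show ?case
    using S T \<open>N < M\<close> Suc.IH[of "insert N T"] Suc.IH[of "insert M T"]
      avoiders_132_0_eq[of S M N T]
    by (simp add: card_Un_disjoint card_Cons_image)
qed

lemma Cons_third_in_avoiders_132_iff:
  assumes S: "S = insert M (insert N (insert K U))" and fin: "finite U"
    and ord: "K < N" "N < M" "\<forall>u\<in>U. u < K"
  shows "K # xs \<in> avoiders_132 S 1 \<longleftrightarrow> xs \<in> (#) N ` avoiders_132 (insert M U) 0"
proof -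
  let ?inv = "pair_count (\<lambda>y z. K < z \<and> z < y)"
  have "{y \<in> S. K < y} = {M, N}" using S ord by (auto dest: less_trans)
  then have two: "card {y \<in> S. K < y} choose 2 = 1"
    using ord by (simp add: numeral_2_eq_2)
  have del: "S - {K} = insert M (insert N U)" using S ord by auto
  have eq: "avoiders_132 (S - {K}) 0
    = (#) M ` avoiders_132 (insert N U) 0 \<union> (#) N ` avoiders_132 (insert M U) 0"
    using ord by (intro avoiders_132_0_eq[OF del fin]) (auto dest: less_trans)
  have "?inv (M # ys) \<noteq> 0" if "ys \<in> avoiders_132 (insert N U) 0" for ys
  proof -
    have "N \<in> set ys" using that by (auto simp: avoiders_132_def permutations_of_set_def)
    then show ?thesis using ord by (auto simp: filter_empty_conv)
  qed
  moreover have "?inv (N # ys) = 0" if ys: "ys \<in> avoiders_132 (insert M U) 0" for ys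
  proof -
    have set: "set ys = insert M U" "distinct ys"
      using ys by (auto simp: avoiders_132_def permutations_of_set_def)
    then have "{y \<in> set ys. K < y} = {M}" using ord by auto
    with pair_count_above[OF \<open>distinct ys\<close>, of K] have "?inv ys = 0" by (simp add: binomial_eq_0)
    moreover have "filter (\<lambda>z. K < z \<and> z < N) ys = []"
      using set ord by (auto simp: filter_empty_conv)
    ultimately show ?thesis by simp
  qed
  moreover have "K # xs \<in> avoiders_132 S 1 \<longleftrightarrow> ?inv xs = 0 \<and> xs \<in> avoiders_132 (S - {K}) 0"
    using S two by (auto simp: Cons_in_avoiders_132_iff)
  ultimately show ?thesis unfolding eq by blast
qed

lemma avoiders_132_1_eq:
  assumes S: "S = insert M (insert N (insert K U))" and fin: "finite U"
    and ord: "K < N" "N < M" "\<forall>u\<in>U. u < K"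
  shows "avoiders_132 S 1 = (#) M ` avoiders_132 (insert N (insert K U)) 1
    \<union> (#) N ` avoiders_132 (insert M (insert K U)) 1
    \<union> (#) K ` (#) N ` avoiders_132 (insert M U) 0"
proof -
  have above: "{y \<in> S. M < y} = {}" "{y \<in> S. N < y} = {M}"
    using S ord by (auto dest: less_trans)
  have low: "card {y \<in> S. M < y} \<le> 1" "card {y \<in> S. N < y} \<le> 1"
    unfolding above by simp_all
  have del: "S - {M} = insert N (insert K U)" "S - {N} = insert M (insert K U)"
    using S ord by auto
  have head: "y = M \<or> y = N \<or> y = K" if "y # ys \<in> avoiders_132 S 1" for y ys
  proof (rule ccontr)
    assume "\<not> (y = M \<or> y = N \<or> y = K)"
    moreover from that have "y \<in> S" and c: "card {z \<in> S. y < z} choose 2 \<le> 1"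
      by (auto simp: Cons_in_avoiders_132_iff)
    ultimately have "y < K" using S ord by auto
    then have "card {M, N, K} \<le> card {z \<in> S. y < z}"
      using S fin ord by (intro card_mono) auto
    moreover have "M \<noteq> N" "M \<noteq> K" "N \<noteq> K" using ord by auto
    then have "card {M, N, K} = 3" by simp
    ultimately show False using le_2_if_choose_2_le_1[OF c] by simp
  qed
  have "M # ys \<in> avoiders_132 S 1 \<longleftrightarrow> ys \<in> avoiders_132 (insert N (insert K U)) 1"
    "N # ys \<in> avoiders_132 S 1 \<longleftrightarrow> ys \<in> avoiders_132 (insert M (insert K U)) 1" for ys
    using Cons_in_avoiders_132_iff_low[OF _ low(1)] Cons_in_avoiders_132_iff_low[OF _ low(2)]
      S del by auto
  then have "y # ys \<in> avoiders_132 S 1 \<longleftrightarrow>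
      y = M \<and> ys \<in> avoiders_132 (insert N (insert K U)) 1
      \<or> y = N \<and> ys \<in> avoiders_132 (insert M (insert K U)) 1
      \<or> y = K \<and> ys \<in> (#) N ` avoiders_132 (insert M U) 0" for y ys
    using head[of y ys] Cons_third_in_avoiders_132_iff[OF assms, of ys] by metis
  moreover have "[] \<notin> avoiders_132 S 1"
    using S by (simp add: Nil_in_avoiders_132_iff)
  ultimately have "xs \<in> avoiders_132 S 1 \<longleftrightarrow>
      xs \<in> (#) M ` avoiders_132 (insert N (insert K U)) 1
        \<union> (#) N ` avoiders_132 (insert M (insert K U)) 1
        \<union> (#) K ` (#) N ` avoiders_132 (insert M U) 0" for xs
    by (cases xs) auto
  then show ?thesis by blast
qed

lemma card_avoiders_132_1:
  fixes S :: "'a::linorder set"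
  assumes "card S = n + 2"
  shows "2 * card (avoiders_132 S 1) = n * 2 ^ n"
  using assms
proof (induction n arbitrary: S)
  case 0
  then have "card S = 2" by simp
  then obtain a b where S: "S = {a, b}" "a \<noteq> b" unfolding card_2_iff by blast
  have "avoiders_132 S 1 = {}"
    using S by (auto simp: avoiders_132_def permutations_of_set_doubleton)
  then show ?case by simp
next
  case (Suc n)
  obtain M S1 where S: "S = insert M S1" "card S1 = Suc (Suc n)" "\<forall>t\<in>S1. t < M"
    using obtain_Max[of S "Suc (Suc n)"] Suc.prems by (metis add_2_eq_Suc')
  obtain N S2 where S1: "S1 = insert N S2" "card S2 = Suc n" "\<forall>t\<in>S2. t < N"
    using obtain_Max[OF S(2)] by metis
  obtain K U where U: "S2 = insert K U" "card U = n" "finite U" "\<forall>t\<in>U. t < K"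
    using obtain_Max[OF S1(2)] by metis
  have ord: "K < N" "N < M" "K < M" and "M \<notin> U" "N \<notin> U" "K \<notin> U" using S S1 U by auto
  then have cards: "card (insert M U) = Suc n" "card (insert M (insert K U)) = n + 2"
    "card (insert N (insert K U)) = n + 2" using U by auto
  let ?A = "(#) M ` avoiders_132 (insert N (insert K U)) 1"
  let ?B = "(#) N ` avoiders_132 (insert M (insert K U)) 1"
  let ?C = "(#) K ` (#) N ` avoiders_132 (insert M U) 0"
  have "?A \<inter> ?B = {}" "(?A \<union> ?B) \<inter> ?C = {}" using ord by auto
  then have "card (?A \<union> ?B \<union> ?C) = card ?A + card ?B + card ?C"
    by (subst card_Un_disjoint; (subst card_Un_disjoint)?) auto
  moreover have "avoiders_132 S 1 = ?A \<union> ?B \<union> ?C"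
    using avoiders_132_1_eq[of S M N K U] S S1 U ord by simp
  ultimately show ?case
    using Suc.IH[OF cards(2)] Suc.IH[OF cards(3)] card_avoiders_132_0[OF cards(1)]
    by (simp add: card_Cons_image)
qed

section \<open>Transfer to permutations\<close>

lemma bij_betw_permutes_permutations_of_set:
  assumes "distinct xs"
  shows "bij_betw (\<lambda>\<pi>. map \<pi> xs) {\<pi>. \<pi> permutes set xs} (permutations_of_set (set xs))"
proof -
  let ?F = "\<lambda>\<pi>. map \<pi> xs"
  have inj: "inj_on ?F {\<pi>. \<pi> permutes set xs}"
  proof (rule inj_onI)
    fix \<pi> \<sigma>
    assume "\<pi> \<in> {\<pi>. \<pi> permutes set xs}" "\<sigma> \<in> {\<pi>. \<pi> permutes set xs}" "?F \<pi> = ?F \<sigma>"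
    then show "\<pi> = \<sigma>"
      by (intro ext) (metis map_eq_conv mem_Collect_eq permutes_not_in)
  qed
  moreover have "?F ` {\<pi>. \<pi> permutes set xs} \<subseteq> permutations_of_set (set xs)"
    using assms
    by (auto simp: permutations_of_set_def permutes_image distinct_map permutes_inj_on
        simp flip: image_set)
  moreover have "card (?F ` {\<pi>. \<pi> permutes set xs}) = card (permutations_of_set (set xs))"
    using inj by (simp add: card_image card_permutations)
  ultimately show ?thesis
    unfolding bij_betw_def by (intro conjI card_subset_eq) simp_all
qed

lemma card_occurrences_123:
  "card (occurrences_123 n \<pi>) = count_123 (map \<pi> [1..<Suc n])"
  unfolding triple_count_map_upt occurrences_123_def
  by (rule arg_cong[where f = card]) auto

lemma avoids_132_iff:
  "avoids_132 n \<pi> \<longleftrightarrow> count_132 (map \<pi> [1..<Suc n]) = 0"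
proof -
  have "finite (occurrences_132 n \<pi>)"
    by (rule finite_subset[of _ "{1..n} \<times> {1..n} \<times> {1..n}"]) (auto simp: occurrences_132_def)
  then have "avoids_132 n \<pi> \<longleftrightarrow> card (occurrences_132 n \<pi>) = 0"
    by (simp add: avoids_132_def)
  also have "card (occurrences_132 n \<pi>) = count_132 (map \<pi> [1..<Suc n])"
    unfolding triple_count_map_upt occurrences_132_def
    by (rule arg_cong[where f = card]) auto
  finally show ?thesis .
qed

theorem theorem1:
  fixes n :: nat
  assumes "n \<ge> 3"
  shows "card {\<pi>. \<pi> permutes {1..n} \<and> card (occurrences_123 n \<pi>) = 1 \<and> avoids_132 n \<pi>}
           = (n - 2) * 2 ^ (n - 3)"
proof -
  let ?F = "\<lambda>\<pi>::nat \<Rightarrow> nat. map \<pi> [1..<Suc n]"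
  let ?X = "{\<pi>. \<pi> permutes {1..n} \<and> card (occurrences_123 n \<pi>) = 1 \<and> avoids_132 n \<pi>}"
  have set: "set [1..<Suc n] = {1..n}" by auto
  have bij: "bij_betw ?F {\<pi>. \<pi> permutes {1..n}} (permutations_of_set {1..n})"
    using bij_betw_permutes_permutations_of_set[of "[1..<Suc n]"] by (simp only: set distinct_upt)
  have "bij_betw ?F
      {\<pi> \<in> {\<pi>. \<pi> permutes {1..n}}. count_123 (?F \<pi>) = 1 \<and> count_132 (?F \<pi>) = 0}
      (avoiders_132 {1..n} 1)"
    unfolding avoiders_132_def by (rule bij_betw_Collect[OF bij refl])
  then have "card ?X = card (avoiders_132 {1..n} 1)"
    unfolding card_occurrences_123 avoids_132_iff mem_Collect_eq by (rule bij_betw_same_card)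
  moreover have "2 * card (avoiders_132 {1..n} 1) = (n - 2) * 2 ^ (n - 2)"
    using assms by (intro card_avoiders_132_1) simp
  moreover have "(2::nat) ^ (n - 2) = 2 * 2 ^ (n - 3)"
    using assms by (simp flip: power_Suc)
  ultimately show ?thesis by simp
qed

end
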